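(* Let $(h(n))_{n\ge1}$ be any sequence of positive real numbers with $h(1)=1$, and for $n\ge2$ let $\rho_n^h$ be the spectral radius of the matrix $M_n^h$. Then \[ 0<\rho_2^h<\rho_3^h<\rho_4^h<\cdots . \]
   Context: Let $\sigma(k)=\sum_{d\mid k}d$. The sequence $(c_n)_{n\ge0}$ is defined by $c_0:=1$ and $c_n:=\sum_{k=0}^{n-1}(-1)^{n-k+1}\sigma(n-k+1)\,c_k$ for $n\ge1$. For $n\ge2$, $M_n^h$ is the $(n-1)\times(n-1)$ matrix with entries, for $1\le i,j\le n-1$, \[ (M_n^h)_{ij}=\begin{cases} c_{i-j+1}\,h(j), & i\ge j-1,\\ 0, & j>i+1.\end{cases} \] *)

theory Defs
  imports "Jordan_Normal_Form.Spectral_Radius"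
begin

definition divisor_sum :: "nat \<Rightarrow> nat" where
  "divisor_sum k = (\<Sum>d | d dvd k. d)"

fun c_seq :: "nat \<Rightarrow> int" where
  "c_seq 0 = 1"
| "c_seq (Suc m) =
     (\<Sum>k<Suc m. (-1) ^ (Suc m - k + 1) * int (divisor_sum (Suc m - k + 1)) * c_seq k)"

text \<open>
  Matrix indices of \<^typ>\<open>real mat\<close> start at 0: entry \<open>(i, j)\<close> below is the entry at
  row \<open>i + 1\<close> and column \<open>j + 1\<close> in 1-based numbering, so the case \<open>i \<ge> j - 1\<close> reads
  \<open>j \<le> i + 1\<close> (no truncated subtraction) and \<open>h (j + 1)\<close> is the column weight.
\<close>

definition M_mat :: "(nat \<Rightarrow> real) \<Rightarrow> nat \<Rightarrow> real mat" where
  "M_mat h n = mat (n - 1) (n - 1)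
     (\<lambda>(i, j). if j \<le> i + 1 then of_int (c_seq (i + 1 - j)) * h (j + 1) else 0)"

text \<open>The library's spectral radius is defined for complex matrices.\<close>

definition rho :: "(nat \<Rightarrow> real) \<Rightarrow> nat \<Rightarrow> real" where
  "rho h n = spectral_radius (map_mat complex_of_real (M_mat h n))"

end

theory Submission
  imports Defs
begin

text \<open>
  All \<open>c_n\<close> are positive: by induction \<open>c_(n+1) \<ge> 5/3 c_n\<close>, because a suitable combination of four
  consecutive instances of the recurrence has dominating positive leading terms, while growth by the
  factor 5/3 bounds the contribution of all but the first 14 terms of each instance.

  Hence the matrices are Hessenberg with positive entries on and below the superdiagonal, and an
  eigenvector for \<open>x\<close> is determined by its first entry, with entries \<open>p_0(x), p_1(x), ...\<close> for
  polynomials \<open>p_k\<close> independent of the size. At the greatest root \<open>r\<close> of \<open>p_n\<close>, where the earlier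
  polynomials are positive, the recurrence makes \<open>p_(n+1)(r)\<close> negative, so the greatest root of
  \<open>p_(n+1)\<close> is larger. The eigenvector at the greatest root is positive, so this root is the spectral
  radius.
\<close>

section \<open>Divisor sums and the recurrence as a convolution\<close>

lemma divisor_sum_alt:
  assumes "n > 0"
  shows "divisor_sum n = (\<Sum>d=1..n. if d dvd n then d else 0)"
proof -
  have "{d. d dvd n} = {d \<in> {1..n}. d dvd n}"
    using assms by (auto dest: dvd_imp_le intro: Suc_leI dvd_pos_nat)
  then show ?thesis
    by (simp add: divisor_sum_def sum.inter_filter[symmetric])
qed

lemma divisor_sum_le:
  assumes "n > 0"
  shows "real (divisor_sum n) \<le> real n * (real n + 1) / 2"
proof -
  have "divisor_sum n \<le> (\<Sum>d=1..n. d)"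
    unfolding divisor_sum_alt[OF assms] by (rule sum_mono) simp
  also have "\<dots> = n * (n + 1) div 2"
    by (simp add: Sum_Icc_nat)
  finally have "2 * divisor_sum n \<le> n * (n + 1)" by simp
  then have "real (2 * divisor_sum n) \<le> real (n * (n + 1))" by (rule of_nat_mono)
  then show ?thesis by (simp add: field_simps)
qed

lemma divisor_sum_simps:
  "divisor_sum 1 = 1" "divisor_sum 2 = 3" "divisor_sum 3 = 4" "divisor_sum 4 = 7"
  "divisor_sum 5 = 6" "divisor_sum 6 = 12" "divisor_sum 7 = 8" "divisor_sum 8 = 15"
  "divisor_sum 9 = 13" "divisor_sum 10 = 18" "divisor_sum 11 = 12" "divisor_sum 12 = 28"
  "divisor_sum 13 = 14" "divisor_sum 14 = 24"
  by (subst divisor_sum_alt, simp, code_simp)+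

text \<open>The shift gives \<open>signed_sigma 0 = 1\<close>, so \<open>c_n\<close> itself becomes
  the term \<open>m = 0\<close> of the recurrence. The generating functions of
  \<open>signed_sigma\<close> and \<open>c_seq\<close> are thus reciprocal.\<close>

definition signed_sigma :: "nat \<Rightarrow> real" where
  "signed_sigma m = (-1) ^ m * real (divisor_sum (m + 1))"

text \<open>Extending the sequence by 0 to negative indices makes the recurrence uniform.\<close>

definition cz :: "int \<Rightarrow> real" where
  "cz k = (if k < 0 then 0 else of_int (c_seq (nat k)))"

lemma c_seq_convolution:
  assumes "n \<ge> 1"
  shows "(\<Sum>m\<le>n. signed_sigma m * of_int (c_seq (n - m))) = 0"
proof -
  obtain m where n: "n = Suc m" using assms by (cases n) auto
  have "(\<Sum>i<n. (-1) ^ (n - i + 1) * real (divisor_sum (n - i + 1)) * of_int (c_seq i)) =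
        - (\<Sum>i<n. signed_sigma (n - i) * of_int (c_seq i))"
    by (simp add: signed_sigma_def sum_negf)
  also have "(\<Sum>i<n. signed_sigma (n - i) * of_int (c_seq i)) =
      (\<Sum>i\<in>{1..n}. signed_sigma i * of_int (c_seq (n - i)))"
    by (rule sum.reindex_bij_witness[of _ "\<lambda>i. n - i" "\<lambda>i. n - i"]) auto
  finally have "of_int (c_seq n) = - (\<Sum>i\<in>{1..n}. signed_sigma i * of_int (c_seq (n - i)))"
    by (simp add: n)
  moreover have "{..n} = insert 0 {1..n}" by auto
  ultimately show ?thesis
    using divisor_sum_simps(1) by (simp add: signed_sigma_def)
qed

lemma cz_convolution:
  assumes "p \<ge> 1" "p < int L"
  shows "(\<Sum>m<L. signed_sigma m * cz (p - int m)) = 0"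
proof -
  have "(\<Sum>m<L. signed_sigma m * cz (p - int m)) = (\<Sum>m\<le>nat p. signed_sigma m * cz (p - int m))"
    by (rule sum.mono_neutral_right) (use assms in \<open>auto simp: cz_def nat_le_iff\<close>)
  also have "\<dots> = (\<Sum>m\<le>nat p. signed_sigma m * of_int (c_seq (nat p - m)))"
    using assms(1) by (intro sum.cong) (auto simp: cz_def nat_diff_distrib')
  finally show ?thesis using c_seq_convolution[of "nat p"] assms by simp
qed

section \<open>Growth of the sequence by the factor 5/3\<close>

text \<open>The bound is the value of the infinite series. With \<open>Q L\<close> the quadratic in
  the closed form below, the summand is \<open>Q L - 3/5 * Q (L + 1)\<close>, so the sum
  telescopes.\<close>

lemma quadratic_geometric_sum_le:
  "(\<Sum>k<L. real (k + 15) * (real (k + 15) + 1) / 2 * (3/5) ^ k) \<le> 2925/8"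
proof -
  have "(\<Sum>k<L. real (k + 15) * (real (k + 15) + 1) / 2 * (3/5) ^ k) =
      2925/8 - (5/4 * real L ^ 2 + 85/2 * real L + 2925/8) * (3/5) ^ L"
  proof (induction L)
    case (Suc L)
    have "real (L + 15) * (real (L + 15) + 1) / 2 =
        (5/4 * real L ^ 2 + 85/2 * real L + 2925/8) -
        (5/4 * real (Suc L) ^ 2 + 85/2 * real (Suc L) + 2925/8) * (3/5)"
      by (simp add: field_simps power2_eq_square)
    then show ?case
      unfolding sum.lessThan_Suc Suc by (simp only: left_diff_distrib power_Suc mult.assoc)
  qed simp
  also have "\<dots> \<le> 2925/8" by simp
  finally show ?thesis .
qed

lemma cz_geometric:
  assumes "\<And>j. j < p \<Longrightarrow> cz j \<le> 3/5 * cz (j + 1)"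
  shows "cz (p - int k) \<le> (3/5) ^ k * cz p"
proof (induction k)
  case (Suc k)
  have "cz (p - int (Suc k)) \<le> 3/5 * cz (p - int k)"
    using assms[of "p - int (Suc k)"] by (simp add: algebra_simps)
  with Suc show ?case by simp
qed simp

text \<open>The full convolution vanishes, so its first 14 terms are minus the tail. There
  \<open>divisor_sum\<close> is bounded by triangular numbers and \<open>cz\<close> decays
  geometrically backwards from \<open>p - 14\<close>.\<close>

lemma cz_recurrence_truncated:
  assumes "p \<ge> 1"
    and le: "\<And>j. j < p - 14 \<Longrightarrow> cz j \<le> 3/5 * cz (j + 1)"
    and nonneg: "\<And>j. j \<le> p - 14 \<Longrightarrow> cz j \<ge> 0"
  shows "\<bar>\<Sum>m<14. signed_sigma m * cz (p - int m)\<bar> \<le> 2925/8 * cz (p - 14)"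
proof -
  define L where "L = nat p"
  define tail where "tail = (\<Sum>k<L. signed_sigma (k + 14) * cz (p - 14 - int k))"
  have "(\<Sum>m<14 + L. signed_sigma m * cz (p - int m)) = 0"
    using assms(1) by (intro cz_convolution) (auto simp: L_def)
  moreover have "(\<Sum>m<14 + L. signed_sigma m * cz (p - int m)) =
      (\<Sum>m<14. signed_sigma m * cz (p - int m)) + tail"
    unfolding tail_def
  proof (induction L)
    case (Suc L)
    then show ?case
      using sum.lessThan_Suc[of "\<lambda>m. signed_sigma m * cz (p - int m)" "14 + L"]
      by (simp add: algebra_simps)
  qed simp
  moreover have "\<bar>tail\<bar> \<le> (\<Sum>k<L. (real (k + 15) * (real (k + 15) + 1) / 2 * (3/5) ^ k) * cz (p - 14))"
    unfolding tail_def
  proof (rule order_trans[OF sum_abs], rule sum_mono)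
    fix k
    have "\<bar>signed_sigma (k + 14) * cz (p - 14 - int k)\<bar> =
        real (divisor_sum (k + 15)) * cz (p - 14 - int k)"
      using nonneg[of "p - 14 - int k"] by (simp add: signed_sigma_def abs_mult add.commute)
    also have "\<dots> \<le> real (k + 15) * (real (k + 15) + 1) / 2 * ((3/5) ^ k * cz (p - 14))"
      using nonneg[of "p - 14 - int k"] divisor_sum_le[of "k + 15"] cz_geometric[of "p - 14" k] le
      by (intro mult_mono) auto
    finally show "\<bar>signed_sigma (k + 14) * cz (p - 14 - int k)\<bar> \<le>
        (real (k + 15) * (real (k + 15) + 1) / 2 * (3/5) ^ k) * cz (p - 14)"
      by (simp add: mult.assoc)
  qed
  moreover have "\<dots> \<le> 2925/8 * cz (p - 14)"
    unfolding sum_distrib_right[symmetric]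
    using quadratic_geometric_sum_le[of L] nonneg[of "p - 14"] by (intro mult_right_mono) auto
  ultimately show ?thesis by linarith
qed

lemma c_seq_initial: "c_seq 1 = 3" "c_seq 2 = 5" "c_seq 3 = 10"
  using divisor_sum_simps(2-4)[unfolded eval_nat_numeral]
  by (simp_all add: eval_nat_numeral)

text \<open>Here \<open>x i\<close> stands for \<open>cz (p - i)\<close>: \<open>decay\<close> is
  the growth already known, and the conclusion is the next growth step. What remains is linear
  arithmetic.\<close>

lemma combined_recurrence_growth:
  fixes x :: "nat \<Rightarrow> real"
  assumes decay: "\<And>i. i \<ge> 1 \<Longrightarrow> x (i + 1) \<le> 3/5 * x i" and "x 17 \<ge> 0"
    and trunc: "\<And>i. i \<le> 3 \<Longrightarrow> \<bar>\<Sum>m<14. signed_sigma m * x (i + m)\<bar> \<le> 2925/8 * x (i + 14)"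
  shows "5 * x 1 \<le> 3 * x 0"
proof -
  define e where "e = (\<lambda>i. \<Sum>m<14. signed_sigma m * x (i + m))"
  have "(\<Sum>m<14. f m) = f 0 + f 1 + f 2 + f 3 + f 4 + f 5 + f 6 + f 7 + f 8 + f 9 + f 10 +
    f 11 + f 12 + f 13" for f :: "nat \<Rightarrow> real"
    by (simp add: eval_nat_numeral)
  then have e: "e i = x i - 3 * x (i + 1) + 4 * x (i + 2) - 7 * x (i + 3) + 6 * x (i + 4)
      - 12 * x (i + 5) + 8 * x (i + 6) - 15 * x (i + 7) + 13 * x (i + 8) - 18 * x (i + 9) + 12 * x (i + 10)
      - 28 * x (i + 11) + 14 * x (i + 12) - 24 * x (i + 13)" for i
    using divisor_sum_simps divisor_sum_simps(1,2)[unfolded numeral_2_eq_2 One_nat_def]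
    unfolding e_def signed_sigma_def by simp
  \<comment> \<open>The signs come from multiplying the generating function of \<open>signed_sigma\<close> by \<open>(1 + X)^2 (1 - X)\<close>,
    which turns it into \<open>1 - 2 X - X^3 - 2 X^4 - 3 X^5 - ...\<close>: the leading terms give growth rate 2.\<close>
  have "e 0 + e 1 - e 2 - e 3 =
    x 0 - 2 * x 1 - x 3 - 2 * x 4 - 3 * x 5 - 3 * x 6 - x 7
      + 2 * x 8 + 2 * x 9 - 4 * x 10 - 11 * x 11 - 8 * x 12 + 6 * x 13
      - 10 * x 14 + 10 * x 15 + 24 * x 16"
    unfolding e by (simp add: eval_nat_numeral)
  moreover have "\<bar>e 0\<bar> \<le> 2925/8 * x 14" "\<bar>e 1\<bar> \<le> 2925/8 * x 15"
    "\<bar>e 2\<bar> \<le> 2925/8 * x 16" "\<bar>e 3\<bar> \<le> 2925/8 * x 17"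
    using trunc[of 0] trunc[of 1] trunc[of 2] trunc[of 3] by (simp_all add: e_def)
  ultimately have "0 \<le> 2925/8 * x 14 + 2925/8 * x 15 + 2925/8 * x 16 + 2925/8 * x 17
    + (x 0 - 2 * x 1 - x 3 - 2 * x 4 - 3 * x 5 - 3 * x 6 - x 7
      + 2 * x 8 + 2 * x 9 - 4 * x 10 - 11 * x 11 - 8 * x 12 + 6 * x 13
      - 10 * x 14 + 10 * x 15 + 24 * x 16)"
    by linarith
  moreover have "x 2 \<le> 3/5 * x 1" "x 3 \<le> 3/5 * x 2" "x 4 \<le> 3/5 * x 3" "x 5 \<le> 3/5 * x 4"
     "x 6 \<le> 3/5 * x 5" "x 7 \<le> 3/5 * x 6" "x 8 \<le> 3/5 * x 7" "x 9 \<le> 3/5 * x 8"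
     "x 10 \<le> 3/5 * x 9" "x 11 \<le> 3/5 * x 10" "x 12 \<le> 3/5 * x 11" "x 13 \<le> 3/5 * x 12"
     "x 14 \<le> 3/5 * x 13" "x 15 \<le> 3/5 * x 14" "x 16 \<le> 3/5 * x 15" "x 17 \<le> 3/5 * x 16"
    using decay[of 1] decay[of 2] decay[of 3] decay[of 4] decay[of 5] decay[of 6]
       decay[of 7] decay[of 8] decay[of 9] decay[of 10] decay[of 11] decay[of 12]
       decay[of 13] decay[of 14] decay[of 15] decay[of 16]
    by (simp_all add: eval_nat_numeral)
  \<comment> \<open>Decay and \<open>x 17 \<ge> 0\<close> make \<open>x 1\<close>, ...,
    \<open>x 17\<close> nonnegative. The coefficient 2 of \<open>x 1\<close> exceeds the required
    5/3; this slack and the other negative terms absorb the positive ones.\<close>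
  ultimately show ?thesis using \<open>x 17 \<ge> 0\<close> by linarith
qed

text \<open>Positivity alone would not survive the alternating signs, so growth is proved along with
  it. The factor 5/3 is attained at \<open>n = 1\<close>.\<close>

lemma c_seq_growth:
  "c_seq n > 0 \<and> 5 * c_seq n \<le> 3 * c_seq (n + 1)"
proof (induction n rule: less_induct)
  case (less n)
  consider "n = 0" | "n = 1" | "n = 2" | "n \<ge> 3" by linarith
  then show ?case
  proof cases
    case 4
    \<comment> \<open>Since \<open>n \<ge> 3\<close>, all four indices \<open>p\<close>, ...,
      \<open>p - 3\<close> are at least 1, as the recurrence requires.\<close>
    define p where "p = int n + 1"
    have pos: "cz j \<ge> 0" if "j \<le> p - 2" for j
      using less[of "nat j"] that by (auto simp: cz_def p_def not_less intro!: less_imp_le simp del: c_seq.simps)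
    have le: "cz j \<le> 3/5 * cz (j + 1)" if "j < p - 1" for j
    proof (cases "j \<ge> 0")
      case True
      then have "5 * c_seq (nat j) \<le> 3 * c_seq (nat j + 1)"
        using less[of "nat j"] that unfolding p_def by linarith
      then have "real_of_int (5 * c_seq (nat j)) \<le> real_of_int (3 * c_seq (nat j + 1))"
        by (simp only: of_int_le_iff)
      then show ?thesis
        using True by (simp add: cz_def nat_add_distrib del: c_seq.simps)
    next
      case False
      then show ?thesis by (auto simp: cz_def)
    qed
    have "5 * cz (p - int 1) \<le> 3 * cz (p - int 0)"
    proof (rule combined_recurrence_growth)
      show "cz (p - int (i + 1)) \<le> 3/5 * cz (p - int i)" if "i \<ge> 1" for i
        using le[of "p - int (i + 1)"] that by (simp add: algebra_simps)
      show "cz (p - int 17) \<ge> 0" by (rule pos) simp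
      show "\<bar>\<Sum>m<14. signed_sigma m * cz (p - int (i + m))\<bar> \<le> 2925/8 * cz (p - int (i + 14))"
        if "i \<le> 3" for i
        using cz_recurrence_truncated[of "p - int i"] le pos that 4
        by (simp add: p_def algebra_simps)
    qed
    moreover have "c_seq n > 0"
      using less[of "n - 1"] 4 by simp
    moreover have "cz (p - int 1) = of_int (c_seq n)" "cz (p - int 0) = of_int (c_seq (n + 1))"
      by (simp_all add: cz_def p_def nat_add_distrib del: c_seq.simps)
    ultimately have "real_of_int (5 * c_seq n) \<le> real_of_int (3 * c_seq (n + 1))" "c_seq n > 0"
      by simp_all
    then show ?thesis
      by (simp only: of_int_le_iff)
  qed (use c_seq_initial in \<open>simp_all add: numeral_2_eq_2 numeral_3_eq_3 del: c_seq.simps(2)\<close>)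
qed

section \<open>Greatest roots and positive eigenvectors\<close>

text \<open>A nonpositive value beyond the greatest root would force a further root, because the
  polynomial is eventually positive.\<close>

lemma poly_greatest_root:
  fixes p :: "real poly"
  assumes "lead_coeff p > 0" and "poly p s = 0"
  obtains r where "poly p r = 0" "s \<le> r" "\<And>x. x > r \<Longrightarrow> poly p x > 0"
proof
  define r where "r = Max {x. poly p x = 0}"
  have "p \<noteq> 0" using assms(1) by auto
  then have fin: "finite {x. poly p x = 0}" by (rule poly_roots_finite)
  from Max_in[OF fin] assms(2) show "poly p r = 0" by (auto simp: r_def)
  from fin assms(2) show "s \<le> r" by (simp add: r_def)
  show "poly p x > 0" if "x > r" for x
  proof (rule ccontr)
    assume neg: "\<not> poly p x > 0"
    obtain N where N: "\<And>y. y \<ge> N \<Longrightarrow> poly p y \<ge> lead_coeff p"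
      using poly_pinfty_gt_lc[OF assms(1)] by blast
    have "poly p x \<noteq> 0"
      using Max_ge[OF fin, of x] that by (auto simp: r_def)
    then have "\<exists>y>x. y < max N (x + 1) \<and> poly p y = 0"
      using N[of "max N (x + 1)"] assms(1) neg by (intro poly_IVT_pos) auto
    then obtain y where "y > x" "poly p y = 0" by blast
    then show False using Max_ge[OF fin, of y] that by (auto simp: r_def)
  qed
qed

text \<open>An elementary part of Perron-Frobenius theory: any complex eigenvector is compared
  entrywise with the positive one.\<close>

lemma spectral_radius_positive_eigenvector:
  fixes A :: "real mat" and v :: "nat \<Rightarrow> real"
  assumes A: "A \<in> carrier_mat n n" and "n > 0"
    and nonneg: "\<And>i j. i < n \<Longrightarrow> j < n \<Longrightarrow> A $$ (i, j) \<ge> 0"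
    and v: "\<And>i. i < n \<Longrightarrow> v i > 0"
    and eig: "\<And>i. i < n \<Longrightarrow> (\<Sum>j<n. A $$ (i, j) * v j) = r * v i"
  shows "spectral_radius (map_mat complex_of_real A) = r"
proof -
  define B where "B = map_mat complex_of_real A"
  have B: "B \<in> carrier_mat n n" using A by (simp add: B_def)
  have B_mult: "(B *\<^sub>v w) $ i = (\<Sum>j<n. complex_of_real (A $$ (i, j)) * w $ j)"
    if "w \<in> carrier_vec n" "i < n" for w i
    using that A by (auto simp: B_def scalar_prod_def lessThan_atLeast0 intro!: sum.cong)
  have "r * v 0 \<ge> 0"
    unfolding eig[OF \<open>n > 0\<close>, symmetric]
    using nonneg \<open>n > 0\<close> v by (intro sum_nonneg mult_nonneg_nonneg) (auto intro: less_imp_le)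
  then have "r \<ge> 0" using v[OF \<open>n > 0\<close>] by (simp add: zero_le_mult_iff)
  define w where "w = vec n (\<lambda>i. complex_of_real (v i))"
  have "eigenvector B w (complex_of_real r)"
    unfolding eigenvector_def
  proof (intro conjI)
    show "w \<in> carrier_vec (dim_row B)" using B by (simp add: w_def)
    show "w \<noteq> 0\<^sub>v (dim_row B)"
    proof
      assume "w = 0\<^sub>v (dim_row B)"
      then have "w $ 0 = 0" using B \<open>n > 0\<close> by simp
      then show False using v[OF \<open>n > 0\<close>] \<open>n > 0\<close> by (simp add: w_def)
    qed
    show "B *\<^sub>v w = complex_of_real r \<cdot>\<^sub>v w"
    proof (rule eq_vecI)
      fix i assume "i < dim_vec (complex_of_real r \<cdot>\<^sub>v w)"
      then have i: "i < n" by (simp add: w_def)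
      have "(B *\<^sub>v w) $ i = complex_of_real (\<Sum>j<n. A $$ (i, j) * v j)"
        using i by (subst B_mult) (auto simp: w_def)
      then show "(B *\<^sub>v w) $ i = (complex_of_real r \<cdot>\<^sub>v w) $ i"
        using i by (simp add: eig w_def)
    qed (use B in \<open>simp add: w_def\<close>)
  qed
  then have mem: "complex_of_real r \<in> spectrum B"
    by (auto simp: spectrum_def eigenvalue_def)
  have le: "norm \<mu> \<le> r" if mu: "\<mu> \<in> spectrum B" for \<mu>
  proof -
    obtain u where u: "u \<in> carrier_vec n" "u \<noteq> 0\<^sub>v n" "B *\<^sub>v u = \<mu> \<cdot>\<^sub>v u"
      using mu carrier_matD[OF B] by (auto simp: spectrum_def eigenvalue_def eigenvector_def)
    \<comment> \<open>The least factor with \<open>norm (u $ j) \<le> t * v j\<close> for all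
      \<open>j\<close>. Equality holds at \<open>k\<close>, and row \<open>k\<close> gives the bound
      on \<open>\<mu>\<close>.\<close>
    define t where "t = Max ((\<lambda>i. norm (u $ i) / v i) ` {..<n})"
    have "t \<in> (\<lambda>i. norm (u $ i) / v i) ` {..<n}"
      unfolding t_def using \<open>n > 0\<close> by (intro Max_in) auto
    then obtain k where k: "k < n" "t = norm (u $ k) / v k" by blast
    have t_ge: "norm (u $ j) \<le> t * v j" if "j < n" for j
    proof -
      have "norm (u $ j) / v j \<le> t" unfolding t_def using that by (intro Max_ge) auto
      then show ?thesis using v[OF that] by (simp add: field_simps)
    qed
    obtain l where l: "l < n" "u $ l \<noteq> 0"
      using u(1,2) by (metis carrier_vecD eq_vecI index_zero_vec)
    have "t > 0"
      using t_ge[OF l(1)] l(2) v[OF l(1)] by (smt (verit) mult_nonpos_nonneg zero_less_norm_iff)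
    have tk: "norm (u $ k) = t * v k" using k v[OF k(1)] by simp
    have "norm \<mu> * (t * v k) = norm ((B *\<^sub>v u) $ k)"
      using u k by (simp add: norm_mult tk)
    also have "\<dots> \<le> (\<Sum>j<n. norm (complex_of_real (A $$ (k, j)) * u $ j))"
      unfolding B_mult[OF u(1) k(1)] by (rule norm_sum)
    also have "\<dots> \<le> (\<Sum>j<n. A $$ (k, j) * (t * v j))"
      using nonneg k(1) t_ge by (intro sum_mono) (auto simp: norm_mult intro!: mult_left_mono)
    also have "\<dots> = t * (\<Sum>j<n. A $$ (k, j) * v j)"
      by (simp add: sum_distrib_left mult_ac)
    also have "\<dots> = r * (t * v k)"
      by (simp add: eig[OF k(1)])
    finally show ?thesis
      using \<open>t > 0\<close> v[OF k(1)] by simp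
  qed
  have "spectral_radius B \<in> norm ` spectrum B"
    using B \<open>n > 0\<close> by (rule spectral_radius_mem_max)
  then have "spectral_radius B \<le> r" using le by auto
  moreover have "norm (complex_of_real r) \<le> spectral_radius B"
    by (rule spectral_radius_mem_max(2)[OF B \<open>n > 0\<close> imageI[OF mem]])
  ultimately show ?thesis using \<open>r \<ge> 0\<close> by (simp add: B_def)
qed

section \<open>Hessenberg matrices with positive entries\<close>

locale positive_hessenberg =
  fixes c h :: "nat \<Rightarrow> real"
  assumes c_pos: "c k > 0" and h_pos: "h k > 0"
begin

text \<open>
  \<open>hess_poly k\<close>, evaluated at \<open>x\<close>, is the \<open>k\<close>-th entry of the vector with first entry 1 that
  the eigenvector equations for \<open>x\<close> determine row by row; the last row of the \<open>n \<times> n\<close> matrix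
  then reads \<open>poly (hess_poly n) x = 0\<close>.
\<close>

fun hess_poly :: "nat \<Rightarrow> real poly" where
  "hess_poly 0 = 1"
| "hess_poly (Suc k) = Polynomial.smult (1 / (c 0 * h (Suc k)))
     (pCons 0 (hess_poly k) - (\<Sum>j<Suc k. Polynomial.smult (c (Suc k - j) * h j) (hess_poly j)))"

lemma hess_poly_recurrence:
  "(\<Sum>j<Suc k. c (Suc k - j) * h j * poly (hess_poly j) x) + c 0 * h (Suc k) * poly (hess_poly (Suc k)) x =
   x * poly (hess_poly k) x"
proof -
  have "c 0 * h (Suc k) \<noteq> 0" using c_pos[of 0] h_pos[of "Suc k"] by simp
  then show ?thesis
    by (simp add: poly_sum del: sum.lessThan_Suc)
qed

text \<open>Only the \<open>pCons\<close> term of the recursion reaches the new degree, and it is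
  scaled by a positive factor.\<close>

lemma hess_poly_degree_coeff:
  "Polynomial.degree (hess_poly k) \<le> k \<and> Polynomial.coeff (hess_poly k) k > 0"
proof (induction k rule: less_induct)
  case (less k)
  show ?case
  proof (cases k)
    case (Suc m)
    define q where "q = (\<Sum>j<Suc m. Polynomial.smult (c (Suc m - j) * h j) (hess_poly j))"
    have "Polynomial.degree q \<le> m"
      unfolding q_def
    proof (intro degree_sum_le)
      fix j assume "j \<in> {..<Suc m}"
      then show "Polynomial.degree (Polynomial.smult (c (Suc m - j) * h j) (hess_poly j)) \<le> m"
        using less[of j] Suc degree_smult_le[of "c (Suc m - j) * h j" "hess_poly j"] by simp
    qed simp
    moreover have "Polynomial.degree (pCons 0 (hess_poly m)) \<le> Suc m"
      using less[of m] Suc by (intro order_trans[OF degree_pCons_le]) auto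
    ultimately have "Polynomial.degree (pCons 0 (hess_poly m) - q) \<le> Suc m" "Polynomial.coeff q (Suc m) = 0"
      by (auto intro: degree_diff_le coeff_eq_0)
    then show ?thesis
      using less[of m] Suc c_pos[of 0] h_pos[of "Suc m"]
      by (auto simp flip: q_def simp del: sum.lessThan_Suc intro!: order_trans[OF degree_smult_le])
  qed simp
qed

lemma hess_poly_lead_coeff: "lead_coeff (hess_poly k) > 0"
  using hess_poly_degree_coeff[of k] le_degree[of "hess_poly k" k] by fastforce

definition hess_mat :: "nat \<Rightarrow> real mat" where
  "hess_mat n = mat n n (\<lambda>(i, j). if j \<le> i + 1 then c (i + 1 - j) * h j else 0)"

text \<open>Positivity of the earlier polynomials makes the eigenvector at \<open>r\<close> positive
  and carries the induction on \<open>n\<close>.\<close>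

definition top_root :: "nat \<Rightarrow> real \<Rightarrow> bool" where
  "top_root n r \<longleftrightarrow> poly (hess_poly n) r = 0 \<and> (\<forall>x>r. poly (hess_poly n) x > 0) \<and>
     (\<forall>k<n. \<forall>x\<ge>r. poly (hess_poly k) x > 0)"

lemma spectral_radius_hess_mat:
  assumes "n > 0" and "top_root n r"
  shows "spectral_radius (map_mat complex_of_real (hess_mat n)) = r"
proof (rule spectral_radius_positive_eigenvector)
  show "hess_mat n \<in> carrier_mat n n" by (simp add: hess_mat_def)
  show "hess_mat n $$ (i, j) \<ge> 0" if "i < n" "j < n" for i j
    using that c_pos h_pos by (simp add: hess_mat_def less_imp_le)
  show "poly (hess_poly i) r > 0" if "i < n" for i
    using assms that by (simp add: top_root_def)
  show "(\<Sum>j<n. hess_mat n $$ (i, j) * poly (hess_poly j) r) = r * poly (hess_poly i) r"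
    if i: "i < n" for i
  proof -
    let ?g = "\<lambda>j. if j \<le> Suc i then c (Suc i - j) * h j * poly (hess_poly j) r else 0"
    have "(\<Sum>j<n. hess_mat n $$ (i, j) * poly (hess_poly j) r) = (\<Sum>j<n. ?g j)"
      using i by (intro sum.cong) (auto simp: hess_mat_def)
    also have "\<dots> = (\<Sum>j<Suc (Suc i). ?g j)"
    proof (cases "Suc i < n")
      case True
      then show ?thesis by (intro sum.mono_neutral_right) auto
    next
      case False
      \<comment> \<open>In the last row the extra summand \<open>j = n\<close> contains
        \<open>poly (hess_poly n) r\<close>, which is 0.\<close>
      then have "n = Suc i" using i by simp
      then show ?thesis using assms(2) by (simp add: top_root_def del: hess_poly.simps)
    qed
    also have "\<dots> = r * poly (hess_poly i) r"
      using hess_poly_recurrence[where k = i and x = r]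
      by (simp del: hess_poly.simps)
    finally show ?thesis .
  qed
qed (use assms in auto)

lemma top_root_1:
  obtains r where "top_root 1 r" "r > 0"
proof -
  \<comment> \<open>This root is the single entry of the 1 by 1 matrix.\<close>
  have "poly (hess_poly 1) (c 1 * h 0) = 0" by simp
  from poly_greatest_root[OF hess_poly_lead_coeff this]
  obtain r where "poly (hess_poly 1) r = 0" "c 1 * h 0 \<le> r" "\<And>x. x > r \<Longrightarrow> poly (hess_poly 1) x > 0" by blast
  moreover have "c 1 * h 0 > 0" using c_pos h_pos by simp
  ultimately show ?thesis
    by (intro that[of r]) (auto simp: top_root_def)
qed

text \<open>At \<open>r\<close> the right side of the recurrence vanishes while the sum over earlier
  polynomials is positive, so the new polynomial is negative there and has a root beyond
  \<open>r\<close>.\<close>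

lemma top_root_Suc:
  assumes "n > 0" and top: "top_root n r"
  obtains s where "top_root (Suc n) s" "r < s"
proof -
  have "(\<Sum>j<Suc n. c (Suc n - j) * h j * poly (hess_poly j) r) > 0"
  proof (rule sum_pos2[of _ 0])
    show "0 < c (Suc n - 0) * h 0 * poly (hess_poly 0) r"
      using c_pos h_pos by simp
    show "0 \<le> c (Suc n - j) * h j * poly (hess_poly j) r" if "j \<in> {..<Suc n}" for j
      using that top c_pos h_pos
      by (cases "j = n") (auto simp: top_root_def intro!: mult_nonneg_nonneg less_imp_le)
  qed auto
  moreover have "poly (hess_poly n) r = 0" using top by (simp add: top_root_def)
  ultimately have "c 0 * h (Suc n) * poly (hess_poly (Suc n)) r < 0"
    using hess_poly_recurrence[of n r] by simp
  then have neg: "poly (hess_poly (Suc n)) r < 0"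
    using c_pos[of 0] h_pos[of "Suc n"] by (simp add: mult_less_0_iff del: hess_poly.simps)
  obtain N where N: "\<And>y. y \<ge> N \<Longrightarrow> poly (hess_poly (Suc n)) y \<ge> lead_coeff (hess_poly (Suc n))"
    using poly_pinfty_gt_lc[OF hess_poly_lead_coeff] by blast
  have "poly (hess_poly (Suc n)) (max N (r + 1)) > 0"
    using N[of "max N (r + 1)"] hess_poly_lead_coeff[of "Suc n"] by linarith
  then obtain y where y: "r < y" "poly (hess_poly (Suc n)) y = 0"
    using poly_IVT_pos[OF _ neg] by (metis less_add_one less_max_iff_disj)
  from poly_greatest_root[OF hess_poly_lead_coeff y(2)]
  obtain s where s: "poly (hess_poly (Suc n)) s = 0" "y \<le> s"
    "\<And>x. x > s \<Longrightarrow> poly (hess_poly (Suc n)) x > 0" by blast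
  \<comment> \<open>For \<open>k = n\<close> positivity holds only beyond \<open>r\<close>;
    \<open>r < s\<close> extends it to all \<open>x \<ge> s\<close>.\<close>
  have "top_root (Suc n) s"
    using s y(1) top by (auto simp: top_root_def less_Suc_eq simp del: hess_poly.simps)
  then show ?thesis using s y(1) by (intro that[of s]) auto
qed

lemma top_root_exists:
  assumes "n > 0"
  shows "\<exists>r. top_root n r"
  using assms
proof (induction n rule: nat_induct_non_zero)
  case 1
  show ?case using top_root_1 by blast
next
  case (Suc n)
  then show ?case using top_root_Suc by blast
qed

lemma spectral_radius_hess_mat_1_pos:
  "spectral_radius (map_mat complex_of_real (hess_mat 1)) > 0"
  using top_root_1 spectral_radius_hess_mat[of 1] by fastforce

lemma spectral_radius_hess_mat_less:
  assumes "n > 0"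
  shows "spectral_radius (map_mat complex_of_real (hess_mat n)) <
    spectral_radius (map_mat complex_of_real (hess_mat (Suc n)))"
proof -
  obtain r where r: "top_root n r" using top_root_exists[OF assms] by blast
  obtain s where "top_root (Suc n) s" "r < s" using top_root_Suc[OF assms r] .
  then show ?thesis
    using spectral_radius_hess_mat[OF assms r] spectral_radius_hess_mat[of "Suc n" s] by simp
qed

end

theorem theorem2p5:
  fixes h :: "nat \<Rightarrow> real"
  assumes "\<And>n. n \<ge> 1 \<Longrightarrow> h n > 0" and "h 1 = 1"
  shows "0 < rho h 2 \<and> (\<forall>n\<ge>2. rho h n < rho h (n + 1))"
proof -
  \<comment> \<open>The locale indexes weights from 0, hence the shift; \<open>M_mat h n\<close>
    becomes \<open>hess_mat (n - 1)\<close>.\<close>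
  interpret positive_hessenberg "\<lambda>k. of_int (c_seq k)" "\<lambda>j. h (j + 1)"
    by standard (use c_seq_growth assms(1) in auto)
  have rho: "rho h n = spectral_radius (map_mat complex_of_real (hess_mat (n - 1)))" for n
    unfolding rho_def M_mat_def hess_mat_def ..
  have "rho h n < rho h (n + 1)" if "n \<ge> 2" for n
    using spectral_radius_hess_mat_less[of "n - 1"] that by (simp add: rho)
  then show ?thesis
    using spectral_radius_hess_mat_1_pos by (simp add: rho)
qed

end
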